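(* Let $S\subset Ent(\mathbb{C})$ be a left amenable semigroup of entire maps. Let $\tilde S$ be the semigroup consisting of the continuous extensions of the elements of $S$ to $\beta(\mathbb{C})$, the Stone–Čech compactification of the complex plane. Then $\tilde S$ admits an invariant probability measure on $\beta(\mathbb{C})$.
   Context: $Ent(\mathbb{C})$ is the semigroup of entire maps of $\mathbb{C}$ under composition. Each entire map $f:\mathbb{C}\to\mathbb{C}\subset\beta(\mathbb{C})$ extends, by the universal property, to a unique continuous map $\tilde f:\beta(\mathbb{C})\to\beta(\mathbb{C})$. A semigroup $S$ is left amenable if there is a finitely additive probability measure $\mu$ defined on all subsets of $S$ with $\mu(l_\gamma^{-1}(A))=\mu(A)$ for all $A\subset S$, $\gamma\in S$, where $l_\gamma(g)=\gamma g$. A Borel probability measure $m$ on $\beta(\mathbb{C})$ is invariant for $\tilde S$ if $m(\tilde f^{-1}(A))=m(A)$ for every $\tilde f\in\tilde S$ and every Borel set $A$. *)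

theory Defs
  imports "HOL-Analysis.Analysis" "HOL-Probability.Probability_Measure"
begin

section \<open>The Stone--Cech compactification of a topological space\<close>

text \<open>
  Members are restricted to be extensional so that a function on \<^term>\<open>topspace X\<close> is
  represented only once.
\<close>

definition unit_functions :: "'a topology \<Rightarrow> ('a \<Rightarrow> real) set" where
  "unit_functions X =
     {\<phi> \<in> extensional (topspace X). continuous_map X (top_of_set {0..1}) \<phi>}"

definition cube :: "'a topology \<Rightarrow> (('a \<Rightarrow> real) \<Rightarrow> real) topology" where
  "cube X = product_topology (\<lambda>\<phi>. top_of_set {0..1}) (unit_functions X)"

definition sc_point :: "'a topology \<Rightarrow> 'a \<Rightarrow> ('a \<Rightarrow> real) \<Rightarrow> real" where
  "sc_point X x = (\<lambda>\<phi>\<in>unit_functions X. \<phi> x)"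

definition stone_cech :: "'a topology \<Rightarrow> (('a \<Rightarrow> real) \<Rightarrow> real) topology" where
  "stone_cech X = subtopology (cube X) (cube X closure_of (sc_point X ` topspace X))"

text \<open>
  The extension of a continuous map from \<open>X\<close> into a compact Hausdorff space \<open>K\<close>; existence
  and uniqueness are \<open>stone_cech_universal\<close> below. The map is made extensional since only its
  values on the compactification are meaningful.
\<close>

definition sc_extension ::
    "'a topology \<Rightarrow> 'b topology \<Rightarrow> ('a \<Rightarrow> 'b) \<Rightarrow> (('a \<Rightarrow> real) \<Rightarrow> real) \<Rightarrow> 'b" where
  "sc_extension X K f =
     (THE F. F \<in> extensional (topspace (stone_cech X)) \<and>
             continuous_map (stone_cech X) K F \<and>
             (\<forall>x\<in>topspace X. F (sc_point X x) = f x))"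

definition sc_lift ::
    "'a topology \<Rightarrow> ('a \<Rightarrow> 'a) \<Rightarrow> (('a \<Rightarrow> real) \<Rightarrow> real) \<Rightarrow> (('a \<Rightarrow> real) \<Rightarrow> real)" where
  "sc_lift X f = sc_extension X (stone_cech X) (sc_point X \<circ> f)"

subsection \<open>Its characteristic properties\<close>

lemma compact_space_cube: "compact_space (cube X)"
  unfolding cube_def
  by (simp add: compact_space_product_topology compact_space_subtopology)

lemma Hausdorff_space_cube: "Hausdorff_space (cube X)"
  unfolding cube_def
  by (simp add: Hausdorff_space_product_topology Hausdorff_space_subtopology)

lemma compact_space_stone_cech: "compact_space (stone_cech X)"
  unfolding stone_cech_def
  by (intro compact_space_subtopology closedin_compact_space[OF compact_space_cube] closedin_closure_of)

lemma Hausdorff_space_stone_cech: "Hausdorff_space (stone_cech X)"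
  unfolding stone_cech_def by (intro Hausdorff_space_subtopology Hausdorff_space_cube)

lemma continuous_map_sc_point_cube: "continuous_map X (cube X) (sc_point X)"
  unfolding cube_def sc_point_def
  by (auto simp: continuous_map_componentwise unit_functions_def cong: restrict_cong)

lemma topspace_stone_cech:
  "topspace (stone_cech X) = cube X closure_of (sc_point X ` topspace X)"
  unfolding stone_cech_def by (simp add: closure_of_subset_topspace inf.absorb2)

lemma sc_point_subset: "sc_point X ` topspace X \<subseteq> topspace (stone_cech X)"
  unfolding topspace_stone_cech
  by (intro closure_of_subset continuous_map_image_subset_topspace continuous_map_sc_point_cube)

lemma continuous_map_sc_point: "continuous_map X (stone_cech X) (sc_point X)"
  using sc_point_subset[of X] continuous_map_sc_point_cube[of X]
  unfolding stone_cech_def topspace_stone_cech[unfolded stone_cech_def]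
  by (auto simp: continuous_map_in_subtopology)

lemma sc_point_dense: "stone_cech X closure_of (sc_point X ` topspace X) = topspace (stone_cech X)"
proof -
  have "sc_point X ` topspace X \<subseteq> cube X closure_of (sc_point X ` topspace X)"
    using sc_point_subset[of X] by (simp add: topspace_stone_cech)
  then show ?thesis
    unfolding topspace_stone_cech
    by (simp add: stone_cech_def closure_of_subtopology inf.absorb2)
qed

lemma unit_functions_eq_mspace:
  "unit_functions X = mspace (submetric (cfunspace X euclidean_metric) {f. f \<in> topspace X \<rightarrow> {0..1::real}})"
proof -
  have "bounded (f ` topspace X)" if "f \<in> topspace X \<rightarrow> {0..1::real}" for f
    using that by (intro bounded_subset[OF bounded_closed_interval[of 0 1]]) auto
  then show ?thesis
    by (auto simp: unit_functions_def continuous_map_in_subtopology)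
qed

lemma embedding_map_sc_point_cube:
  assumes "completely_regular_space X" "Hausdorff_space X"
  shows "embedding_map X (cube X) (sc_point X)"
  using completely_regular_space_cube_embedding_explicit[OF assms]
  unfolding cube_def sc_point_def[abs_def] unit_functions_eq_mspace .

lemma embedding_map_sc_point:
  assumes "completely_regular_space X" "Hausdorff_space X"
  shows "embedding_map X (stone_cech X) (sc_point X)"
  using embedding_map_sc_point_cube[OF assms] sc_point_subset[of X]
  unfolding stone_cech_def topspace_stone_cech[unfolded stone_cech_def]
  by (auto simp: embedding_map_in_subtopology)

theorem stone_cech_universal:
  fixes X :: "'a topology" and K :: "'b topology"
  assumes K: "compact_space K" "Hausdorff_space K" and f: "continuous_map X K f"
  shows "\<exists>!F. F \<in> extensional (topspace (stone_cech X)) \<and>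
              continuous_map (stone_cech X) K F \<and>
              (\<forall>x\<in>topspace X. F (sc_point X x) = f x)"
proof (rule ex_ex1I)
  let ?B = "stone_cech X"
  have cr: "completely_regular_space K"
    using K by (simp add: compact_Hausdorff_or_regular_imp_normal_space
        normal_imp_completely_regular_space)
  obtain r where r: "homeomorphic_maps K (subtopology (cube K) (sc_point K ` topspace K)) (sc_point K) r"
    using embedding_map_sc_point_cube[OF cr K(2)]
    by (auto simp: embedding_map_def homeomorphic_map_maps)
  define c where "c \<psi> = restrict (\<psi> \<circ> f) (topspace X)" for \<psi> :: "'b \<Rightarrow> real"
  have c: "c \<psi> \<in> unit_functions X" if "\<psi> \<in> unit_functions K" for \<psi>
  proof -
    have "continuous_map X (top_of_set {0..1}) (\<psi> \<circ> f)"
      using that f by (auto simp: unit_functions_def intro: continuous_map_compose)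
    then show ?thesis
      unfolding c_def unit_functions_def by (auto intro: continuous_map_eq)
  qed
  define G where "G p = (\<lambda>\<psi>\<in>unit_functions K. p (c \<psi>))" for p :: "('a \<Rightarrow> real) \<Rightarrow> real"
  have "continuous_map (cube X) (top_of_set {0..1}) (\<lambda>p. p (c \<psi>))"
    if "\<psi> \<in> unit_functions K" for \<psi>
    using c[OF that] unfolding cube_def by (rule continuous_map_product_projection)
  then have G: "continuous_map (cube X) (cube K) G"
    unfolding cube_def[of K] G_def
    by (auto simp: continuous_map_componentwise cong: restrict_cong)
  have Gx: "G (sc_point X x) = sc_point K (f x)" if "x \<in> topspace X" for x
    using that c by (auto simp: G_def sc_point_def c_def fun_eq_iff)
  have fX: "f ` topspace X \<subseteq> topspace K"
    using f by (rule continuous_map_image_subset_topspace)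
  have "compactin (cube K) (sc_point K ` topspace K)"
    using K(1) continuous_map_sc_point_cube[of K] by (auto simp: compact_space_def intro: image_compactin)
  then have cl: "closedin (cube K) (sc_point K ` topspace K)"
    by (intro compactin_imp_closedin Hausdorff_space_cube)
  have "G ` topspace ?B \<subseteq> cube K closure_of (G ` (sc_point X ` topspace X))"
    unfolding topspace_stone_cech by (rule continuous_map_image_closure_subset[OF G])
  also have "\<dots> \<subseteq> sc_point K ` topspace K"
    using fX by (intro closure_of_minimal cl) (auto simp: Gx)
  finally have "continuous_map ?B (subtopology (cube K) (sc_point K ` topspace K)) G"
    using G unfolding continuous_map_in_subtopology
    by (auto simp: stone_cech_def continuous_map_from_subtopology)
  then have "continuous_map ?B K (r \<circ> G)"
    using r by (auto simp: homeomorphic_maps_def intro: continuous_map_compose)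
  then have 1: "continuous_map ?B K (restrict (r \<circ> G) (topspace ?B))"
    by (rule continuous_map_eq) auto
  have 2: "restrict (r \<circ> G) (topspace ?B) (sc_point X x) = f x" if "x \<in> topspace X" for x
    using that sc_point_subset[of X] r fX by (auto simp: Gx homeomorphic_maps_def)
  show "\<exists>F. F \<in> extensional (topspace ?B) \<and> continuous_map ?B K F \<and>
            (\<forall>x\<in>topspace X. F (sc_point X x) = f x)"
    using 1 2 by (intro exI[of _ "restrict (r \<circ> G) (topspace ?B)"]) auto
next
  fix F F'
  assume F: "F \<in> extensional (topspace (stone_cech X)) \<and> continuous_map (stone_cech X) K F \<and>
              (\<forall>x\<in>topspace X. F (sc_point X x) = f x)"
    and F': "F' \<in> extensional (topspace (stone_cech X)) \<and> continuous_map (stone_cech X) K F' \<and>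
              (\<forall>x\<in>topspace X. F' (sc_point X x) = f x)"
  show "F = F'"
  proof (rule extensionalityI)
    fix p assume "p \<in> topspace (stone_cech X)"
    then have "p \<in> stone_cech X closure_of (sc_point X ` topspace X)"
      by (simp add: sc_point_dense)
    then show "F p = F' p"
      by (rule forall_in_closure_of_eq[OF _ K(2)]) (use F F' in auto)
  qed (use F F' in auto)
qed

lemma
  assumes "continuous_map X X f"
  shows continuous_map_sc_lift: "continuous_map (stone_cech X) (stone_cech X) (sc_lift X f)"
    and sc_lift_sc_point: "x \<in> topspace X \<Longrightarrow> sc_lift X f (sc_point X x) = sc_point X (f x)"
    and sc_lift_extensional: "sc_lift X f \<in> extensional (topspace (stone_cech X))"
  using theI'[OF stone_cech_universal[OF compact_space_stone_cech Hausdorff_space_stone_cech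
        continuous_map_compose[OF assms continuous_map_sc_point]]]
  by (auto simp: sc_lift_def sc_extension_def)


section \<open>Invariant Borel probability measures\<close>

text \<open>
  The library constant \<^const>\<open>borel\<close> belongs to a type class, whereas here the topology is
  a value and its carrier a proper subset of the type.
\<close>

definition borel_of_topology :: "'a topology \<Rightarrow> 'a measure" where
  "borel_of_topology T = sigma (topspace T) {U. openin T U}"

definition invariant_borel_probability :: "'a topology \<Rightarrow> ('a \<Rightarrow> 'a) set \<Rightarrow> 'a measure \<Rightarrow> bool" where
  "invariant_borel_probability T \<F> m \<longleftrightarrow>
     prob_space m \<and> sets m = sets (borel_of_topology T) \<and>
     (\<forall>F\<in>\<F>. \<forall>A\<in>sets m. emeasure m (F -` A \<inter> topspace T) = emeasure m A)"


section \<open>Amenable semigroups of entire maps\<close>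

definition Ent :: "(complex \<Rightarrow> complex) set" where
  "Ent = {f. f holomorphic_on UNIV}"

definition left_amenable :: "('a \<Rightarrow> 'a \<Rightarrow> 'a) \<Rightarrow> 'a set \<Rightarrow> bool" where
  "left_amenable opr S \<longleftrightarrow>
     (\<exists>\<mu> :: 'a set \<Rightarrow> real.
        (\<forall>A\<subseteq>S. 0 \<le> \<mu> A) \<and> \<mu> S = 1 \<and> additive (Pow S) \<mu> \<and>
        (\<forall>\<gamma>\<in>S. \<forall>A\<subseteq>S. \<mu> {g \<in> S. opr \<gamma> g \<in> A} = \<mu> A))"

end

theory Submission
  imports Defs
begin

text \<open>
  Pushing a left invariant mean \<open>\<mu>\<close> on \<open>S\<close> forward along the orbit \<open>g \<mapsto> g 0\<close> gives a
  finitely additive probability \<open>\<nu>\<close> on \<^emph>\<open>all\<close> subsets of \<open>\<beta>(\<complex>)\<close>, and left invariance of \<open>\<mu>\<close>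
  makes every lifted map preserve \<open>\<nu>\<close>. What is missing is countable
  additivity, and compactness supplies it.

  On a compact Hausdorff space \<open>T\<close>, a finitely additive probability \<open>\<nu>\<close> is regularized
  directly, without passing through the functional \<open>\<integral> \<phi> d\<nu>\<close> and a representation theorem:
  an open set \<open>U\<close> gets the mass \<open>sup {\<nu> K | K \<subseteq> U closed}\<close>, an arbitrary set the infimum of
  the masses of its open supersets. Compactness reduces a countable cover of a closed set to a
  finite one, and normality cuts the closed set into closed pieces subordinate to that finite
  cover; so this is an outer measure (lemma \<open>outer_mass_countably_subadditive\<close>). Open sets
  satisfy the Caratheodory criterion (lemma \<open>open_in_lambda_system\<close>), whence a Borel probability.

  The regularization respects symmetries. If a continuous \<open>F\<close> preserves \<open>\<nu>\<close>, then \<open>F\<close> is also a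
  closed map, so closed subsets of \<open>U\<close> and closed subsets of \<open>F\<^sup>-\<^sup>1 U\<close> can be traded for one
  another by preimages and images without losing \<open>\<nu>\<close>-mass (lemma \<open>inner_mass_vimage\<close>). Thus the
  Borel measure and its image under \<open>F\<close> agree on open sets, a generator stable under
  intersection, and therefore everywhere.
\<close>

section \<open>Regularizing a finitely additive probability on a compact Hausdorff space\<close>

text \<open>A charge is a finitely additive measure defined on all subsets.\<close>

locale compact_Hausdorff_charge =
  fixes T :: "'a topology" and \<nu> :: "'a set \<Rightarrow> real"
  assumes compact: "compact_space T" and Hausdorff: "Hausdorff_space T"
    and nonneg: "\<And>A. A \<subseteq> topspace T \<Longrightarrow> 0 \<le> \<nu> A"
    and additive: "additive (Pow (topspace T)) \<nu>"
    and total: "\<nu> (topspace T) = 1"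
begin

lemma charge_Un: "A \<subseteq> topspace T \<Longrightarrow> B \<subseteq> topspace T \<Longrightarrow> A \<inter> B = {} \<Longrightarrow> \<nu> (A \<union> B) = \<nu> A + \<nu> B"
  using additive by (simp add: additive_def)

lemma charge_empty: "\<nu> {} = 0"
  using charge_Un[of "{}" "{}"] by simp

lemma charge_mono:
  assumes "A \<subseteq> B" "B \<subseteq> topspace T"
  shows "\<nu> A \<le> \<nu> B"
proof -
  have "\<nu> (A \<union> (B - A)) = \<nu> A + \<nu> (B - A)"
    using assms by (intro charge_Un) auto
  moreover have "A \<union> (B - A) = B"
    using assms by auto
  ultimately show ?thesis
    using nonneg[of "B - A"] assms by auto
qed

lemma charge_Un_le:
  assumes "A \<subseteq> topspace T" "B \<subseteq> topspace T"
  shows "\<nu> (A \<union> B) \<le> \<nu> A + \<nu> B"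
proof -
  have "\<nu> (A \<union> (B - A)) = \<nu> A + \<nu> (B - A)"
    using assms by (intro charge_Un) auto
  moreover have "\<nu> (B - A) \<le> \<nu> B"
    using assms by (intro charge_mono) auto
  ultimately show ?thesis by simp
qed

definition inner_mass :: "'a set \<Rightarrow> ennreal" where
  "inner_mass U = (SUP K\<in>{K. closedin T K \<and> K \<subseteq> U}. ennreal (\<nu> K))"

definition outer_mass :: "'a set \<Rightarrow> ennreal" where
  "outer_mass A = (INF U\<in>{U. openin T U \<and> A \<subseteq> U}. inner_mass U)"

lemma inner_mass_upper: "closedin T K \<Longrightarrow> K \<subseteq> U \<Longrightarrow> ennreal (\<nu> K) \<le> inner_mass U"
  unfolding inner_mass_def by (rule SUP_upper) simp

lemma inner_mass_least:
  "(\<And>K. closedin T K \<Longrightarrow> K \<subseteq> U \<Longrightarrow> ennreal (\<nu> K) \<le> c) \<Longrightarrow> inner_mass U \<le> c"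
  unfolding inner_mass_def by (rule SUP_least) simp

lemma inner_mass_mono: "U \<subseteq> V \<Longrightarrow> inner_mass U \<le> inner_mass V"
  by (intro inner_mass_least inner_mass_upper) auto

lemma outer_mass_lower: "openin T U \<Longrightarrow> A \<subseteq> U \<Longrightarrow> outer_mass A \<le> inner_mass U"
  unfolding outer_mass_def by (rule INF_lower) simp

lemma outer_mass_greatest:
  "(\<And>U. openin T U \<Longrightarrow> A \<subseteq> U \<Longrightarrow> c \<le> inner_mass U) \<Longrightarrow> c \<le> outer_mass A"
  unfolding outer_mass_def by (rule INF_greatest) simp

lemma outer_mass_open: "openin T U \<Longrightarrow> outer_mass U = inner_mass U"
  by (intro antisym outer_mass_lower outer_mass_greatest inner_mass_mono) auto

lemma outer_mass_mono: "A \<subseteq> B \<Longrightarrow> outer_mass A \<le> outer_mass B"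
  by (intro outer_mass_greatest outer_mass_lower) auto

lemma inner_mass_topspace: "inner_mass (topspace T) = 1"
proof (rule antisym)
  show "inner_mass (topspace T) \<le> 1"
  proof (rule inner_mass_least)
    fix K assume "closedin T K"
    then have "\<nu> K \<le> 1"
      using charge_mono[of K "topspace T"] total closedin_subset by auto
    then show "ennreal (\<nu> K) \<le> 1"
      by simp
  qed
  show "1 \<le> inner_mass (topspace T)"
    using inner_mass_upper[of "topspace T" "topspace T"] total by simp
qed

lemma outer_mass_empty: "outer_mass {} = 0"
proof -
  have "inner_mass {} \<le> 0"
    by (rule inner_mass_least) (simp add: charge_empty)
  then show ?thesis
    by (simp add: outer_mass_open)
qed

text \<open>
  This is where normality enters: the parts of \<open>K\<close> outside \<open>U\<close> and outside \<open>V\<close> are disjoint closed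
  sets, and removing from \<open>K\<close> a separating neighbourhood of either leaves a closed piece.
\<close>

lemma closed_split:
  assumes K: "closedin T K" "K \<subseteq> U \<union> V" and UV: "openin T U" "openin T V"
  obtains L M where "closedin T L" "closedin T M" "L \<subseteq> U" "M \<subseteq> V" "K = L \<union> M"
proof -
  have "closedin T (K - U)" "closedin T (K - V)"
    using K UV by (auto intro: closedin_diff)
  moreover have "disjnt (K - U) (K - V)"
    using K by (auto simp: disjnt_def)
  moreover have "normal_space T"
    using compact Hausdorff by (simp add: compact_Hausdorff_or_regular_imp_normal_space)
  ultimately obtain P Q where PQ: "openin T P" "openin T Q" "K - U \<subseteq> P" "K - V \<subseteq> Q" "disjnt P Q"
    unfolding normal_space_def by metis
  show ?thesis
  proof (rule that[of "K - P" "K - Q"])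
    show "closedin T (K - P)" "closedin T (K - Q)"
      using K PQ by (auto intro: closedin_diff)
  qed (use K PQ in \<open>auto simp: disjnt_def\<close>)
qed

lemma charge_le_sum_inner_mass:
  fixes U :: "nat \<Rightarrow> 'a set"
  assumes "\<And>i. openin T (U i)" "closedin T K" "K \<subseteq> (\<Union>i<n. U i)"
  shows "ennreal (\<nu> K) \<le> (\<Sum>i<n. inner_mass (U i))"
  using assms(2,3)
proof (induction n arbitrary: K)
  case 0
  then show ?case by (simp add: charge_empty)
next
  case (Suc n)
  have "K \<subseteq> (\<Union>i<n. U i) \<union> U n"
    using Suc.prems by (simp add: lessThan_Suc Un_commute)
  then obtain L M where LM: "closedin T L" "closedin T M" "L \<subseteq> (\<Union>i<n. U i)" "M \<subseteq> U n" "K = L \<union> M"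
    using closed_split[OF Suc.prems(1)] assms(1) by (metis openin_Union imageE)
  have sub: "L \<subseteq> topspace T" "M \<subseteq> topspace T"
    using LM(1,2) by (auto dest: closedin_subset)
  have "ennreal (\<nu> K) \<le> ennreal (\<nu> L + \<nu> M)"
    using charge_Un_le[OF sub] LM by (auto intro: ennreal_leI)
  also have "\<dots> = ennreal (\<nu> L) + ennreal (\<nu> M)"
    using nonneg sub by simp
  also have "\<dots> \<le> (\<Sum>i<n. inner_mass (U i)) + inner_mass (U n)"
    using LM by (intro add_mono Suc.IH inner_mass_upper)
  finally show ?case by simp
qed

lemma inner_mass_UN_le:
  fixes U :: "nat \<Rightarrow> 'a set"
  assumes "\<And>i. openin T (U i)"
  shows "inner_mass (\<Union>i. U i) \<le> (\<Sum>i. inner_mass (U i))"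
proof (rule inner_mass_least)
  fix K assume K: "closedin T K" "K \<subseteq> (\<Union>i. U i)"
  have "compactin T K"
    using K compact by (simp add: closedin_compact_space)
  then obtain \<F> where \<F>: "finite \<F>" "\<F> \<subseteq> range U" "K \<subseteq> \<Union>\<F>"
    using compactinD[of T K "range U"] K assms by auto
  then obtain I where I: "finite I" "\<F> = U ` I"
    by (metis finite_subset_image)
  then obtain n where "I \<subseteq> {..<n}"
    using finite_nat_iff_bounded by auto
  then have "K \<subseteq> (\<Union>i<n. U i)"
    using \<F> I by blast
  then have "ennreal (\<nu> K) \<le> (\<Sum>i<n. inner_mass (U i))"
    using charge_le_sum_inner_mass assms K by blast
  also have "\<dots> \<le> (\<Sum>i. inner_mass (U i))"
    by (intro sum_le_suminf) auto
  finally show "ennreal (\<nu> K) \<le> (\<Sum>i. inner_mass (U i))" .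
qed

text \<open>
  Each set is replaced by an open superset whose mass exceeds its own by at most
  \<open>e / 2\<^bsup>n+1\<^esup>\<close>, which reduces the claim to open sets.
\<close>

lemma outer_mass_countably_subadditive:
  "countably_subadditive (Pow (topspace T)) outer_mass"
  unfolding countably_subadditive_def
proof (intro allI impI)
  fix A :: "nat \<Rightarrow> 'a set"
  show "outer_mass (\<Union>i. A i) \<le> (\<Sum>i. outer_mass (A i))"
  proof (rule ennreal_le_epsilon)
    fix e :: real assume e: "0 < e" "(\<Sum>i. outer_mass (A i)) < top"
    have "outer_mass (A n) < outer_mass (A n) + ennreal (e * (1/2)^Suc n)" for n
      using e by (auto simp: less_top dest!: ennreal_suminf_lessD)
    then have "\<exists>U. openin T U \<and> A n \<subseteq> U \<and> inner_mass U < outer_mass (A n) + ennreal (e * (1/2)^Suc n)" for n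
      by (subst (asm) outer_mass_def) (simp only: INF_less_iff mem_Collect_eq, blast)
    then obtain U where U: "\<And>n. openin T (U n)" "\<And>n. A n \<subseteq> U n"
      "\<And>n. inner_mass (U n) < outer_mass (A n) + ennreal (e * (1/2)^Suc n)"
      by metis
    have "outer_mass (\<Union>i. A i) \<le> inner_mass (\<Union>i. U i)"
      using U by (intro outer_mass_lower openin_Union) auto
    also have "\<dots> \<le> (\<Sum>i. inner_mass (U i))"
      by (rule inner_mass_UN_le) (rule U)
    also have "\<dots> \<le> (\<Sum>i. outer_mass (A i) + ennreal (e * (1/2)^Suc i))"
      using U by (intro suminf_le less_imp_le) auto
    also have "\<dots> = (\<Sum>i. outer_mass (A i)) + (\<Sum>i. ennreal e * ennreal ((1/2)^Suc i))"
      using e by (subst suminf_add[symmetric])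
        (auto simp del: ennreal_suminf_cmult simp add: ennreal_mult[symmetric])
    also have "\<dots> = (\<Sum>i. outer_mass (A i)) + ennreal e"
      unfolding ennreal_suminf_cmult
      by (subst suminf_ennreal_eq[OF zero_le_power power_half_series]) auto
    finally show "outer_mass (\<Union>i. A i) \<le> (\<Sum>i. outer_mass (A i)) + ennreal e" .
  qed
qed

lemma outer_measure_space_outer_mass: "outer_measure_space (Pow (topspace T)) outer_mass"
  unfolding outer_measure_space_def
  by (auto simp: positive_def increasing_def outer_mass_empty
      intro: outer_mass_mono outer_mass_countably_subadditive)

text \<open>
  Filling \<open>V \<inter> U\<close> by a closed \<open>K\<close> leaves the open set \<open>V - K\<close>, which covers \<open>V - U\<close>; a closed
  \<open>L \<subseteq> V - K\<close> is disjoint from \<open>K\<close>, so finite additivity of \<open>\<nu>\<close> on \<open>K \<union> L\<close> gives the estimate.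
\<close>

lemma inner_mass_split_ge:
  assumes "openin T U" "openin T V"
  shows "inner_mass (V \<inter> U) + outer_mass (V - U) \<le> inner_mass V"
proof -
  have *: "ennreal (\<nu> K) + outer_mass (V - U) \<le> inner_mass V"
    if K: "closedin T K" "K \<subseteq> V \<inter> U" for K
  proof -
    have "ennreal (\<nu> K) + ennreal (\<nu> L) \<le> inner_mass V" if L: "closedin T L" "L \<subseteq> V - K" for L
    proof -
      have sub: "K \<subseteq> topspace T" "L \<subseteq> topspace T"
        using K L closedin_subset by auto
      have "ennreal (\<nu> K) + ennreal (\<nu> L) = ennreal (\<nu> (K \<union> L))"
      proof -
        have "K \<inter> L = {}"
          using L by auto
        then show ?thesis
          using sub nonneg by (simp add: charge_Un)
      qed
      also have "\<dots> \<le> inner_mass V"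
        using K L by (intro inner_mass_upper closedin_Un) auto
      finally show ?thesis .
    qed
    moreover have "{L. closedin T L \<and> L \<subseteq> V - K} \<noteq> {}"
      using closedin_empty by blast
    ultimately have "ennreal (\<nu> K) + inner_mass (V - K) \<le> inner_mass V"
      unfolding inner_mass_def[of "V - K"]
      by (subst ennreal_SUP_add_right) (auto intro!: SUP_least)
    moreover have "outer_mass (V - U) \<le> inner_mass (V - K)"
      using K assms by (intro outer_mass_lower openin_diff) auto
    ultimately show ?thesis
      by (meson add_left_mono order_trans)
  qed
  moreover have "{K. closedin T K \<and> K \<subseteq> V \<inter> U} \<noteq> {}"
    using closedin_empty by blast
  ultimately show ?thesis
    unfolding inner_mass_def[of "V \<inter> U"]
    by (subst ennreal_SUP_add_left[symmetric]) (auto intro!: SUP_least)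
qed

lemma open_in_lambda_system:
  assumes U: "openin T U"
  shows "U \<in> lambda_system (topspace T) (Pow (topspace T)) outer_mass"
proof -
  interpret sigma_algebra "topspace T" "Pow (topspace T)"
    by (rule sigma_algebra_Pow)
  have "outer_mass (A \<inter> U) + outer_mass (A - U) \<le> outer_mass A" for A
  proof (rule outer_mass_greatest)
    fix V assume V: "openin T V" "A \<subseteq> V"
    have "outer_mass (A \<inter> U) + outer_mass (A - U) \<le> inner_mass (V \<inter> U) + outer_mass (V - U)"
      using U V by (intro add_mono outer_mass_lower outer_mass_mono) auto
    also have "\<dots> \<le> inner_mass V"
      by (rule inner_mass_split_ge[OF U V(1)])
    finally show "outer_mass (A \<inter> U) + outer_mass (A - U) \<le> inner_mass V" .
  qed
  moreover have "outer_mass A \<le> outer_mass (A \<inter> U) + outer_mass (A - U)"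
    if "A \<subseteq> topspace T" for A
  proof -
    have "subadditive (Pow (topspace T)) outer_mass"
      using outer_measure_space_outer_mass countably_subadditive_subadditive
      by (auto simp: outer_measure_space_def)
    moreover have "A = (A \<inter> U) \<union> (A - U)"
      by auto
    ultimately show ?thesis
      using that subadditiveD[of "Pow (topspace T)" outer_mass "A \<inter> U" "A - U"] by auto
  qed
  ultimately show ?thesis
    using openin_subset[OF U] by (auto simp: lambda_system_eq intro: antisym)
qed

definition regularization :: "'a measure" where
  "regularization = measure_of (topspace T) {U. openin T U} outer_mass"

lemma open_sets_subset_Pow: "{U. openin T U} \<subseteq> Pow (topspace T)"
  using openin_subset by auto

lemma sets_regularization: "sets regularization = sigma_sets (topspace T) {U. openin T U}"
  unfolding regularization_def using open_sets_subset_Pow by (rule sets_measure_of)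

lemma space_regularization: "space regularization = topspace T"
  unfolding regularization_def using open_sets_subset_Pow by (rule space_measure_of)

lemma sets_regularization_borel: "sets regularization = sets (borel_of_topology T)"
  by (simp add: sets_regularization borel_of_topology_def sets_measure_of[OF open_sets_subset_Pow])

lemma emeasure_regularization_open:
  assumes "openin T U"
  shows "emeasure regularization U = inner_mass U"
proof -
  interpret sigma_algebra "topspace T" "Pow (topspace T)"
    by (rule sigma_algebra_Pow)
  let ?L = "lambda_system (topspace T) (Pow (topspace T)) outer_mass"
  have ms: "measure_space (topspace T) ?L outer_mass"
    by (rule caratheodory_lemma[OF outer_measure_space_outer_mass])
  then have "sigma_algebra (topspace T) ?L"
    by (simp add: measure_space_def)
  then have sub: "sigma_sets (topspace T) {U. openin T U} \<subseteq> ?L"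
    by (rule sigma_algebra.sigma_sets_subset) (auto intro: open_in_lambda_system)
  have "positive (sets regularization) outer_mass"
    by (simp add: positive_def outer_mass_empty)
  moreover have "countably_additive (sets regularization) outer_mass"
    using ms sub unfolding measure_space_def countably_additive_def sets_regularization by blast
  moreover have "U \<in> sets regularization"
    using assms by (simp add: sets_regularization)
  ultimately have "emeasure regularization U = outer_mass U"
    using open_sets_subset_Pow by (intro emeasure_measure_of[OF regularization_def])
  then show ?thesis
    using assms by (simp add: outer_mass_open)
qed

lemma prob_space_regularization: "prob_space regularization"
  by (rule prob_spaceI)
    (simp add: space_regularization emeasure_regularization_open inner_mass_topspace)

text \<open>
  For \<open>\<le>\<close> a closed subset \<open>K\<close> of the preimage is traded for \<open>F ` K\<close>, which is closed, being a
  compact subset of a Hausdorff space, and has no less mass because \<open>K\<close> lies in its preimage; for \<open>\<ge>\<close> a closed subset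
  of \<open>U\<close> is traded for its preimage.
\<close>

lemma inner_mass_vimage:
  assumes F: "continuous_map T T F"
    and inv: "\<And>A. A \<subseteq> topspace T \<Longrightarrow> \<nu> (F -` A \<inter> topspace T) = \<nu> A"
  shows "inner_mass (F -` U \<inter> topspace T) = inner_mass U"
proof (rule antisym)
  show "inner_mass (F -` U \<inter> topspace T) \<le> inner_mass U"
  proof (rule inner_mass_least)
    fix K assume K: "closedin T K" "K \<subseteq> F -` U \<inter> topspace T"
    have "compactin T (F ` K)"
      using F K compact by (auto intro: image_compactin closedin_compact_space)
    then have FK: "closedin T (F ` K)"
      using Hausdorff by (simp add: compactin_imp_closedin)
    have "\<nu> K \<le> \<nu> (F -` (F ` K) \<inter> topspace T)"
      using K by (intro charge_mono) auto
    also have "\<dots> = \<nu> (F ` K)"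
      using FK by (intro inv closedin_subset)
    finally have "ennreal (\<nu> K) \<le> ennreal (\<nu> (F ` K))"
      by (rule ennreal_leI)
    also have "\<dots> \<le> inner_mass U"
      using FK K by (intro inner_mass_upper) auto
    finally show "ennreal (\<nu> K) \<le> inner_mass U" .
  qed
  show "inner_mass U \<le> inner_mass (F -` U \<inter> topspace T)"
  proof (rule inner_mass_least)
    fix K assume K: "closedin T K" "K \<subseteq> U"
    have "closedin T (F -` K \<inter> topspace T)"
      using closedin_continuous_map_preimage[OF F K(1)] by (simp add: vimage_def Int_def conj_commute)
    then have "ennreal (\<nu> (F -` K \<inter> topspace T)) \<le> inner_mass (F -` U \<inter> topspace T)"
      using K by (intro inner_mass_upper) auto
    then show "ennreal (\<nu> K) \<le> inner_mass (F -` U \<inter> topspace T)"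
      using inv[OF closedin_subset[OF K(1)]] by simp
  qed
qed

lemma emeasure_regularization_vimage:
  assumes F: "continuous_map T T F"
    and inv: "\<And>A. A \<subseteq> topspace T \<Longrightarrow> \<nu> (F -` A \<inter> topspace T) = \<nu> A"
    and A: "A \<in> sets regularization"
  shows "emeasure regularization (F -` A \<inter> topspace T) = emeasure regularization A"
proof -
  let ?m = regularization and ?E = "{U. openin T U}"
  have vim: "openin T (F -` U \<inter> topspace T)" if "openin T U" for U
    using openin_continuous_map_preimage[OF F that] by (simp add: vimage_def Int_def conj_commute)
  have meas: "F \<in> measurable ?m ?m"
  proof (rule measurable_sigma_sets[OF sets_regularization open_sets_subset_Pow])
    show "F \<in> space ?m \<rightarrow> topspace T"
      using F by (auto simp: space_regularization continuous_map_def)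
    show "F -` U \<inter> space ?m \<in> sets ?m" if "U \<in> ?E" for U
      using vim that by (auto simp: space_regularization sets_regularization)
  qed
  have "distr ?m ?m F = ?m"
  proof (rule measure_eqI_generator_eq[where E = ?E and \<Omega> = "topspace T" and A = "\<lambda>_. topspace T"])
    show "Int_stable ?E"
      by (auto simp: Int_stable_def)
    show "?E \<subseteq> Pow (topspace T)"
      by (rule open_sets_subset_Pow)
    fix U assume "U \<in> ?E"
    then have U: "openin T U" by simp
    then have "emeasure (distr ?m ?m F) U = emeasure ?m (F -` U \<inter> topspace T)"
      using meas by (subst emeasure_distr) (auto simp: sets_regularization space_regularization)
    also have "\<dots> = emeasure ?m U"
      using U vim inner_mass_vimage[OF F inv] by (simp add: emeasure_regularization_open)
    finally show "emeasure (distr ?m ?m F) U = emeasure ?m U" .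
  next
    show "emeasure (distr ?m ?m F) (topspace T) \<noteq> \<infinity>" for i :: nat
      using prob_space.prob_space_distr[OF prob_space_regularization meas]
      by (simp add: prob_space.finite_measure finite_measure.emeasure_finite)
  qed (auto simp: sets_regularization)
  then show ?thesis
    using emeasure_distr[OF meas A] by (simp add: space_regularization)
qed

theorem invariant_borel_probability_regularization:
  assumes "\<And>F. F \<in> \<F> \<Longrightarrow> continuous_map T T F"
    and "\<And>F A. F \<in> \<F> \<Longrightarrow> A \<subseteq> topspace T \<Longrightarrow> \<nu> (F -` A \<inter> topspace T) = \<nu> A"
  shows "invariant_borel_probability T \<F> regularization"
  using assms prob_space_regularization sets_regularization_borel
  by (auto simp: invariant_borel_probability_def intro: emeasure_regularization_vimage)

end

section \<open>Invariant measures for left amenable semigroups\<close>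

text \<open>
  Only the orbit of a single point \<open>x\<close> of \<open>X\<close> is used, so the lifted maps enter through their values
  on \<open>X\<close> itself: the lift of \<open>f\<close> carries the image of \<open>g x\<close> to the image of \<open>(f \<circ> g) x\<close>.
\<close>

theorem left_amenable_imp_invariant_borel_probability:
  fixes X :: "'a topology"
  assumes cont: "\<And>f. f \<in> S \<Longrightarrow> continuous_map X X f"
    and comp: "\<And>f g. f \<in> S \<Longrightarrow> g \<in> S \<Longrightarrow> f \<circ> g \<in> S"
    and "left_amenable (\<circ>) S"
    and x: "x \<in> topspace X"
  shows "\<exists>m. invariant_borel_probability (stone_cech X) (sc_lift X ` S) m"
proof -
  obtain \<mu> :: "('a \<Rightarrow> 'a) set \<Rightarrow> real"
    where \<mu>: "\<And>A. A \<subseteq> S \<Longrightarrow> 0 \<le> \<mu> A" "\<mu> S = 1" "additive (Pow S) \<mu>"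
      and inv: "\<And>\<gamma> A. \<gamma> \<in> S \<Longrightarrow> A \<subseteq> S \<Longrightarrow> \<mu> {g \<in> S. \<gamma> \<circ> g \<in> A} = \<mu> A"
    using assms(3) unfolding left_amenable_def by blast
  define orbit where "orbit g = sc_point X (g x)" for g
  define \<nu> where "\<nu> A = \<mu> {g \<in> S. orbit g \<in> A}" for A
  have gx: "g x \<in> topspace X" if "g \<in> S" for g
    using cont[OF that] x by (auto simp: continuous_map_def)
  then have orbit: "orbit g \<in> topspace (stone_cech X)" if "g \<in> S" for g
    using that sc_point_subset[of X] by (auto simp: orbit_def)
  interpret compact_Hausdorff_charge "stone_cech X" \<nu>
  proof
    show "compact_space (stone_cech X)" "Hausdorff_space (stone_cech X)"
      by (rule compact_space_stone_cech Hausdorff_space_stone_cech)+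
    show "0 \<le> \<nu> A" for A
      unfolding \<nu>_def by (rule \<mu>) auto
    show "additive (Pow (topspace (stone_cech X))) \<nu>"
    proof -
      have "\<nu> (A \<union> B) = \<nu> A + \<nu> B" if "A \<inter> B = {}" for A B
      proof -
        have "{g \<in> S. orbit g \<in> A \<union> B} = {g \<in> S. orbit g \<in> A} \<union> {g \<in> S. orbit g \<in> B}"
          by auto
        moreover have "{g \<in> S. orbit g \<in> A} \<inter> {g \<in> S. orbit g \<in> B} = {}"
          using that by auto
        ultimately show ?thesis
          unfolding \<nu>_def using additiveD[OF \<mu>(3)] by auto
      qed
      then show ?thesis by (simp add: additive_def)
    qed
    have "{g \<in> S. orbit g \<in> topspace (stone_cech X)} = S"
      using orbit by auto
    then show "\<nu> (topspace (stone_cech X)) = 1"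
      using \<mu> by (simp add: \<nu>_def)
  qed
  have "\<nu> (sc_lift X f -` A \<inter> topspace (stone_cech X)) = \<nu> A" if f: "f \<in> S" for f A
  proof -
    have "sc_lift X f (orbit g) = orbit (f \<circ> g)" if "g \<in> S" for g
      using sc_lift_sc_point[OF cont[OF f] gx[OF that]] by (simp add: orbit_def)
    then have "{g \<in> S. orbit g \<in> sc_lift X f -` A \<inter> topspace (stone_cech X)}
        = {g \<in> S. f \<circ> g \<in> {h \<in> S. orbit h \<in> A}}"
      using comp[OF f] orbit by auto
    then show ?thesis
      unfolding \<nu>_def using inv[OF f, of "{h \<in> S. orbit h \<in> A}"] by auto
  qed
  then have "invariant_borel_probability (stone_cech X) (sc_lift X ` S) regularization"
    using cont by (intro invariant_borel_probability_regularization) (auto intro: continuous_map_sc_lift)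
  then show ?thesis ..
qed

theorem theorem17:
  fixes S :: "(complex \<Rightarrow> complex) set"
  assumes "S \<subseteq> Ent"
    and "\<And>f g. f \<in> S \<Longrightarrow> g \<in> S \<Longrightarrow> f \<circ> g \<in> S"
    and "left_amenable (\<circ>) S"
  shows "\<exists>m. invariant_borel_probability (stone_cech euclidean) (sc_lift euclidean ` S) m"
proof (rule left_amenable_imp_invariant_borel_probability[where x = 0])
  show "continuous_map euclidean euclidean f" if "f \<in> S" for f
    using assms(1) that by (auto simp: Ent_def intro: holomorphic_on_imp_continuous_on)
qed (use assms in auto)

end
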